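(* Let $n_1,n_2 \geq 1$ and $d_1,d_2 \geq 0$. Let $G_1 \in ER(n_1,d_1,\lambda)$ have a uniform shared neighborhood structure isomorphic to $X$, and let $G_2 \in ER(n_2,d_2,\lambda)$ have a uniform shared neighborhood structure isomorphic to $Y$. Then $G_1 \square G_2 \in ER(n_1n_2,d_1+d_2,\lambda)$ has a uniform shared neighborhood structure if and only if $X \cong Y$, in which case the uniform shared neighborhood structure of $G_1\square G_2$ is isomorphic to $X$ ($\cong Y$).
   Context: For a finite simple graph $G$, $N(u)$ is the open neighborhood of $u$. $G \in ER(n,d,\lambda)$ means $G$ has $n$ vertices, is $d$-regular, and every pair of adjacent vertices has exactly $\lambda$ common neighbors. $G$ has a uniform shared neighborhood structure isomorphic to $H$ if the induced subgraph $G[N(u)\cap N(v)]$ is isomorphic to $H$ for all adjacent $u,v$; $G$ "has a uniform shared neighborhood structure" if such an $H$ exists. The Cartesian product $G_1\square G_2$ has vertex set $V(G_1)\times V(G_2)$, with $(u,u')\sim(v,v')$ iff either $u=v$ and $u'\sim v'$ in $G_2$, or $u\sim v$ in $G_1$ and $u'=v'$.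
   Formalization: The direction "the product has a uniform shared neighborhood structure implies X ≅ Y" is stated only for d_1, d_2 > 0; if d_1 = 0 or d_2 = 0, X or Y is vacuously arbitrary and this direction fails (K_1 with X = K_2, and the octahedron). All else is stated for all d_1, d_2 ≥ 0. *)

theory Defs
  imports "Graph_Theory.Graph_Theory"
begin

text \<open>Finite simple graphs are \<open>pair_graph\<close>s: each edge is the pair of arcs \<open>(u, v)\<close>, \<open>(v, u)\<close>.
  The null graph is allowed; it is the shared neighborhood structure when \<open>l = 0\<close>.\<close>

definition nbhd :: "'a pair_pre_digraph \<Rightarrow> 'a \<Rightarrow> 'a set" where
  "nbhd G u = {v. (u, v) \<in> parcs G}"

definition ER :: "nat \<Rightarrow> nat \<Rightarrow> nat \<Rightarrow> 'a pair_pre_digraph set" where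
  "ER n d l = {G. pair_graph G \<and> card (pverts G) = n
     \<and> (\<forall>u \<in> pverts G. card (nbhd G u) = d)
     \<and> (\<forall>u v. (u, v) \<in> parcs G \<longrightarrow> card (nbhd G u \<inter> nbhd G v) = l)}"

definition graph_iso :: "'a pair_pre_digraph \<Rightarrow> 'b pair_pre_digraph \<Rightarrow> bool" (infix \<open>\<cong>\<^sub>g\<close> 50) where
  "G \<cong>\<^sub>g H \<longleftrightarrow> digraph_iso (with_proj G) (with_proj H)"

definition uniform_shared_nbhd_iso :: "'a pair_pre_digraph \<Rightarrow> 'b pair_pre_digraph \<Rightarrow> bool" where
  "uniform_shared_nbhd_iso G H \<longleftrightarrow>
     (\<forall>u v. (u, v) \<in> parcs G \<longrightarrow>
        digraph_iso (with_proj G \<restriction> (nbhd G u \<inter> nbhd G v)) (with_proj H))"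

text \<open>Letting \<open>H\<close> range over graphs on the vertex type of \<open>G\<close> loses nothing: if \<open>G\<close> has an
  edge, any witness is isomorphic to an induced subgraph of \<open>G\<close>; otherwise every \<open>H\<close> is a witness.\<close>

definition has_uniform_shared_nbhd :: "'a pair_pre_digraph \<Rightarrow> bool" where
  "has_uniform_shared_nbhd G \<longleftrightarrow>
     (\<exists>H :: 'a pair_pre_digraph. pair_graph H \<and> uniform_shared_nbhd_iso G H)"

definition cart_prod ::
    "'a pair_pre_digraph \<Rightarrow> 'b pair_pre_digraph \<Rightarrow> ('a \<times> 'b) pair_pre_digraph" (infixl \<open>\<box>\<close> 70) where
  "G\<^sub>1 \<box> G\<^sub>2 = \<lparr> pverts = pverts G\<^sub>1 \<times> pverts G\<^sub>2,
     parcs = {((u, u'), (v, v')) | u u' v v'.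
       (u \<in> pverts G\<^sub>1 \<and> u = v \<and> (u', v') \<in> parcs G\<^sub>2) \<or>
       ((u, v) \<in> parcs G\<^sub>1 \<and> u' \<in> pverts G\<^sub>2 \<and> u' = v')} \<rparr>"

end

theory Submission
  imports Defs
begin

text \<open>
  A common neighbour of the two ends of an edge inside a fibre \<open>G\<^sub>1 \<times> {w}\<close> or
  \<open>{w} \<times> G\<^sub>2\<close> lies in that fibre, so the shared neighborhood of a product edge is a copy of
  the shared neighborhood of the edge it projects to. Edges of the two kinds thus realise \<open>X\<close>
  and \<open>Y\<close> respectively, and both kinds occur exactly when both degrees are positive.
\<close>

section \<open>Pair graphs and their Cartesian product\<close>

lemma parcs_cart_prod_iff:
  "((u, u'), (v, v')) \<in> parcs (G\<^sub>1 \<box> G\<^sub>2) \<longleftrightarrow>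
     (u \<in> pverts G\<^sub>1 \<and> u = v \<and> (u', v') \<in> parcs G\<^sub>2) \<or>
     ((u, v) \<in> parcs G\<^sub>1 \<and> u' \<in> pverts G\<^sub>2 \<and> u' = v')"
  by (auto simp: cart_prod_def)

lemma pverts_cart_prod: "pverts (G\<^sub>1 \<box> G\<^sub>2) = pverts G\<^sub>1 \<times> pverts G\<^sub>2"
  by (simp add: cart_prod_def)

text \<open>Locale facts turned into rules with an explicit graph, so that two factors and their
  product can be handled side by side.\<close>

lemma pair_graphD:
  assumes "pair_graph G"
  shows "(u, v) \<in> parcs G \<Longrightarrow> u \<in> pverts G"
    and "(u, v) \<in> parcs G \<Longrightarrow> v \<in> pverts G"
    and "(u, v) \<in> parcs G \<Longrightarrow> (v, u) \<in> parcs G"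
    and "(u, u) \<notin> parcs G"
    and "finite (pverts G)"
proof -
  interpret pair_graph G by fact
  show "(u, v) \<in> parcs G \<Longrightarrow> u \<in> pverts G" "(u, v) \<in> parcs G \<Longrightarrow> v \<in> pverts G"
    by (auto dest: wellformed')
  show "(u, v) \<in> parcs G \<Longrightarrow> (v, u) \<in> parcs G"
    by (rule arcs_symmetric)
  show "(u, u) \<notin> parcs G"
    using no_loops' by blast
  show "finite (pverts G)"
    by (rule pair_finite_verts)
qed

text \<open>Checking tails suffices: by symmetry every head is also a tail, and then the arcs lie in
  the finite square of the vertex set.\<close>

lemma pair_graphI:
  assumes fin: "finite (pverts G)"
    and verts: "\<And>u v. (u, v) \<in> parcs G \<Longrightarrow> u \<in> pverts G"
    and sym: "\<And>u v. (u, v) \<in> parcs G \<Longrightarrow> (v, u) \<in> parcs G"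
    and irrefl: "\<And>u. (u, u) \<notin> parcs G"
  shows "pair_graph G"
proof
  show "finite (parcs G)"
    by (rule finite_subset[of _ "pverts G \<times> pverts G"]) (use fin verts sym in auto)
  show "symmetric (with_proj G)"
    using sym by (auto simp: symmetric_def intro: symI)
qed (use fin verts sym irrefl in \<open>auto, force\<close>)

lemma wf_digraph_with_proj: "pair_graph G \<Longrightarrow> wf_digraph (with_proj G)"
  by (auto simp: wf_digraph_def dest: pair_graphD(1,2))

lemma finite_nbhd: "pair_graph G \<Longrightarrow> finite (nbhd G u)"
  by (rule finite_subset[of _ "pverts G"]) (auto simp: nbhd_def pair_graphD(5) dest: pair_graphD(2))

lemma pair_graph_cart_prod:
  assumes "pair_graph G\<^sub>1" "pair_graph G\<^sub>2"
  shows "pair_graph (G\<^sub>1 \<box> G\<^sub>2)"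
  by (rule pair_graphI)
    (auto simp: parcs_cart_prod_iff pverts_cart_prod assms[THEN pair_graphD(4)]
        assms[THEN pair_graphD(5)]
      dest: assms[THEN pair_graphD(1)] assms[THEN pair_graphD(3)])

section \<open>Neighborhoods and shared neighborhoods in the product\<close>

lemma nbhd_cart_prod:
  assumes "u \<in> pverts G\<^sub>1" "u' \<in> pverts G\<^sub>2"
  shows "nbhd (G\<^sub>1 \<box> G\<^sub>2) (u, u') = Pair u ` nbhd G\<^sub>2 u' \<union> (\<lambda>x. (x, u')) ` nbhd G\<^sub>1 u"
  using assms by (auto simp: nbhd_def parcs_cart_prod_iff)

lemma card_nbhd_cart_prod:
  assumes "pair_graph G\<^sub>1" "pair_graph G\<^sub>2" "u \<in> pverts G\<^sub>1" "u' \<in> pverts G\<^sub>2"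
  shows "card (nbhd (G\<^sub>1 \<box> G\<^sub>2) (u, u')) = card (nbhd G\<^sub>1 u) + card (nbhd G\<^sub>2 u')"
proof -
  \<comment> \<open>A common element of the two images could only be \<open>(u, u')\<close>, which
    would need a loop at \<open>u\<close> and at \<open>u'\<close>.\<close>
  have "Pair u ` nbhd G\<^sub>2 u' \<inter> (\<lambda>x. (x, u')) ` nbhd G\<^sub>1 u = {}"
    using assms by (auto simp: nbhd_def pair_graphD(4))
  then show ?thesis
    using assms
    by (simp add: nbhd_cart_prod card_Un_disjoint finite_nbhd card_image inj_on_def)
qed

text \<open>Suppose a neighbor \<open>(u, y)\<close> of \<open>(u, w)\<close> with \<open>y\<close>
  adjacent to \<open>w\<close> were also adjacent to \<open>(v, w)\<close>. Then
  \<open>u = v\<close> or \<open>y = w\<close>, and either one is a loop in a factor. So both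
  adjacencies of a common neighbor run along \<open>G\<^sub>1\<close>.\<close>

lemma shared_nbhd_cart_prod_left:
  assumes "pair_graph G\<^sub>1" "pair_graph G\<^sub>2" "(u, v) \<in> parcs G\<^sub>1" "w \<in> pverts G\<^sub>2"
  shows "nbhd (G\<^sub>1 \<box> G\<^sub>2) (u, w) \<inter> nbhd (G\<^sub>1 \<box> G\<^sub>2) (v, w)
    = (\<lambda>x. (x, w)) ` (nbhd G\<^sub>1 u \<inter> nbhd G\<^sub>1 v)"
  using assms pair_graphD(1,2)[OF assms(1)] pair_graphD(1,2)[OF assms(2)]
  by (auto simp: nbhd_def parcs_cart_prod_iff pair_graphD(4))

lemma shared_nbhd_cart_prod_right:
  assumes "pair_graph G\<^sub>1" "pair_graph G\<^sub>2" "(u, v) \<in> parcs G\<^sub>2" "w \<in> pverts G\<^sub>1"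
  shows "nbhd (G\<^sub>1 \<box> G\<^sub>2) (w, u) \<inter> nbhd (G\<^sub>1 \<box> G\<^sub>2) (w, v)
    = Pair w ` (nbhd G\<^sub>2 u \<inter> nbhd G\<^sub>2 v)"
  using assms pair_graphD(1,2)[OF assms(1)] pair_graphD(1,2)[OF assms(2)]
  by (auto simp: nbhd_def parcs_cart_prod_iff pair_graphD(4))

text \<open>An injection that preserves and reflects arcs on \<open>S\<close> is itself the
  isomorphism onto its image. It is applied to the embeddings of the factors as fibres.\<close>

lemma digraph_iso_induce_image:
  assumes "pair_graph G" "inj_on f S"
    and "\<And>x y. x \<in> S \<Longrightarrow> y \<in> S \<Longrightarrow> (f x, f y) \<in> parcs H \<longleftrightarrow> (x, y) \<in> parcs G"
  shows "digraph_iso (with_proj G \<restriction> S) (with_proj H \<restriction> (f ` S))"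
proof -
  \<comment> \<open>Arcs of \<open>with_proj\<close> are pairs, so the arc map applies
    \<open>f\<close> to both ends, and tail and head of the target remain the projections.\<close>
  define hom where "hom = \<lparr>iso_verts = f, iso_arcs = map_prod f f, iso_head = snd, iso_tail = fst\<rparr>"
  have "wf_digraph (with_proj G \<restriction> S)"
    using assms(1) by (intro wf_digraph.wellformed_induce_subgraph wf_digraph_with_proj)
  moreover have "inj_on (map_prod f f) {e \<in> parcs G. fst e \<in> S \<and> snd e \<in> S}"
    by (rule inj_on_subset[OF map_prod_inj_on[OF assms(2) assms(2)]]) auto
  ultimately have "pre_digraph.digraph_isomorphism (with_proj G \<restriction> S) hom"
    using assms(2) by (simp add: pre_digraph.digraph_isomorphism_def hom_def)
  \<comment> \<open>\<open>digraph_iso\<close> asks for equality with the relabelled digraph. The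
    arc sets agree because the arc condition on \<open>S\<close> is an equivalence: one direction
    gives each inclusion.\<close>
  moreover have "with_proj H \<restriction> (f ` S) = app_iso hom (with_proj G \<restriction> S)"
    using assms(3) by (auto simp: hom_def app_iso_def induce_subgraph_def image_iff) force
  ultimately show ?thesis
    by (auto simp: digraph_iso_def)
qed

lemma digraph_iso_shared_nbhd_left:
  assumes "pair_graph G\<^sub>1" "pair_graph G\<^sub>2" "(u, v) \<in> parcs G\<^sub>1" "w \<in> pverts G\<^sub>2"
  shows "digraph_iso (with_proj G\<^sub>1 \<restriction> (nbhd G\<^sub>1 u \<inter> nbhd G\<^sub>1 v))
    (with_proj (G\<^sub>1 \<box> G\<^sub>2) \<restriction> (nbhd (G\<^sub>1 \<box> G\<^sub>2) (u, w) \<inter> nbhd (G\<^sub>1 \<box> G\<^sub>2) (v, w)))"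
  unfolding shared_nbhd_cart_prod_left[OF assms]
  by (rule digraph_iso_induce_image)
    (use assms in \<open>auto simp: inj_on_def parcs_cart_prod_iff pair_graphD(4)\<close>)

lemma digraph_iso_shared_nbhd_right:
  assumes "pair_graph G\<^sub>1" "pair_graph G\<^sub>2" "(u, v) \<in> parcs G\<^sub>2" "w \<in> pverts G\<^sub>1"
  shows "digraph_iso (with_proj G\<^sub>2 \<restriction> (nbhd G\<^sub>2 u \<inter> nbhd G\<^sub>2 v))
    (with_proj (G\<^sub>1 \<box> G\<^sub>2) \<restriction> (nbhd (G\<^sub>1 \<box> G\<^sub>2) (w, u) \<inter> nbhd (G\<^sub>1 \<box> G\<^sub>2) (w, v)))"
  unfolding shared_nbhd_cart_prod_right[OF assms]
  by (rule digraph_iso_induce_image)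
    (use assms in \<open>auto simp: inj_on_def parcs_cart_prod_iff pair_graphD(4)\<close>)

text \<open>Reversing an isomorphism requires a well-formed source; an induced subgraph inherits
  this from \<open>G\<close>.\<close>

lemma digraph_iso_induce_swap:
  assumes "pair_graph G" "digraph_iso (with_proj G \<restriction> S) H"
  shows "digraph_iso H (with_proj G \<restriction> S)"
  by (rule digraph_iso_swap[OF wf_digraph.wellformed_induce_subgraph assms(2)])
    (rule wf_digraph_with_proj[OF assms(1)])

section \<open>Parameters of the product\<close>

lemma cart_prod_in_ER:
  assumes G1: "G\<^sub>1 \<in> ER n\<^sub>1 d\<^sub>1 l" and G2: "G\<^sub>2 \<in> ER n\<^sub>2 d\<^sub>2 l"
  shows "G\<^sub>1 \<box> G\<^sub>2 \<in> ER (n\<^sub>1 * n\<^sub>2) (d\<^sub>1 + d\<^sub>2) l"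
proof -
  have pg: "pair_graph G\<^sub>1" "pair_graph G\<^sub>2"
    using assms by (auto simp: ER_def)
  \<comment> \<open>The fibre embeddings are injective, so each product edge keeps the count of the
    edge it projects to; the two kinds agree because the factors share \<open>l\<close>.\<close>
  have "card (nbhd (G\<^sub>1 \<box> G\<^sub>2) p \<inter> nbhd (G\<^sub>1 \<box> G\<^sub>2) q) = l" if pq: "(p, q) \<in> parcs (G\<^sub>1 \<box> G\<^sub>2)" for p q
  proof -
    obtain u u' v v' where [simp]: "p = (u, u')" "q = (v, v')"
      by (cases p, cases q)
    from pq consider "u \<in> pverts G\<^sub>1" "u = v" "(u', v') \<in> parcs G\<^sub>2"
      | "(u, v) \<in> parcs G\<^sub>1" "u' \<in> pverts G\<^sub>2" "u' = v'"
      by (auto simp: parcs_cart_prod_iff)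
    then show ?thesis
    proof cases
      case 1
      then show ?thesis
        using G2 by (simp add: shared_nbhd_cart_prod_right[OF pg] card_image inj_on_def ER_def)
    next
      case 2
      then show ?thesis
        using G1 by (simp add: shared_nbhd_cart_prod_left[OF pg] card_image inj_on_def ER_def)
    qed
  qed
  then show ?thesis
    using assms pair_graph_cart_prod[OF pg]
    by (auto simp: ER_def pverts_cart_prod card_cartesian_product card_nbhd_cart_prod)
qed

section \<open>Uniform structures passing between factors and product\<close>

lemma uniform_shared_nbhd_iso_trans:
  assumes "uniform_shared_nbhd_iso G X" "X \<cong>\<^sub>g Y"
  shows "uniform_shared_nbhd_iso G Y"
  using assms by (auto simp: uniform_shared_nbhd_iso_def graph_iso_def intro: digraph_iso_trans)

lemma uniform_shared_nbhd_iso_cart_prod: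
  assumes pg: "pair_graph G\<^sub>1" "pair_graph G\<^sub>2"
    and X: "uniform_shared_nbhd_iso G\<^sub>1 X" "uniform_shared_nbhd_iso G\<^sub>2 X"
  shows "uniform_shared_nbhd_iso (G\<^sub>1 \<box> G\<^sub>2) X"
  unfolding uniform_shared_nbhd_iso_def
proof (intro allI impI)
  fix p q assume pq: "(p, q) \<in> parcs (G\<^sub>1 \<box> G\<^sub>2)"
  obtain u u' v v' where [simp]: "p = (u, u')" "q = (v, v')"
    by (cases p, cases q)
  from pq consider "u \<in> pverts G\<^sub>1" "u = v" "(u', v') \<in> parcs G\<^sub>2"
    | "(u, v) \<in> parcs G\<^sub>1" "u' \<in> pverts G\<^sub>2" "u' = v'"
    by (auto simp: parcs_cart_prod_iff)
  then show "digraph_iso (with_proj (G\<^sub>1 \<box> G\<^sub>2) \<restriction> (nbhd (G\<^sub>1 \<box> G\<^sub>2) p \<inter> nbhd (G\<^sub>1 \<box> G\<^sub>2) q)) (with_proj X)"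
  proof cases
    case 1
    \<comment> \<open>The copy isomorphism runs from factor to product; reversed, it starts a chain
      from the product through the factor to \<open>X\<close>.\<close>
    note digraph_iso_induce_swap[OF pg(2) digraph_iso_shared_nbhd_right[OF pg 1(3,1)]]
    also have "digraph_iso (with_proj G\<^sub>2 \<restriction> (nbhd G\<^sub>2 u' \<inter> nbhd G\<^sub>2 v')) (with_proj X)"
      using X(2) 1 by (simp add: uniform_shared_nbhd_iso_def)
    finally show ?thesis
      using 1 by simp
  next
    case 2
    note digraph_iso_induce_swap[OF pg(1) digraph_iso_shared_nbhd_left[OF pg 2(1,2)]]
    also have "digraph_iso (with_proj G\<^sub>1 \<restriction> (nbhd G\<^sub>1 u \<inter> nbhd G\<^sub>1 v)) (with_proj X)"
      using X(1) 2 by (simp add: uniform_shared_nbhd_iso_def)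
    finally show ?thesis
      using 2 by simp
  qed
qed

text \<open>A fixed vertex of the other factor lifts every edge of a factor to a product edge with
  an isomorphic shared neighborhood; this is why both factors must be nonempty.\<close>

lemma uniform_shared_nbhd_iso_cart_prodD:
  assumes pg: "pair_graph G\<^sub>1" "pair_graph G\<^sub>2"
    and ne: "pverts G\<^sub>1 \<noteq> {}" "pverts G\<^sub>2 \<noteq> {}"
    and H: "uniform_shared_nbhd_iso (G\<^sub>1 \<box> G\<^sub>2) H"
  shows "uniform_shared_nbhd_iso G\<^sub>1 H" and "uniform_shared_nbhd_iso G\<^sub>2 H"
proof -
  obtain w\<^sub>1 w\<^sub>2 where w: "w\<^sub>1 \<in> pverts G\<^sub>1" "w\<^sub>2 \<in> pverts G\<^sub>2"
    using ne by auto
  show "uniform_shared_nbhd_iso G\<^sub>1 H"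
    unfolding uniform_shared_nbhd_iso_def
  proof (intro allI impI)
    fix u v assume uv: "(u, v) \<in> parcs G\<^sub>1"
    then have "((u, w\<^sub>2), (v, w\<^sub>2)) \<in> parcs (G\<^sub>1 \<box> G\<^sub>2)"
      using w by (simp add: parcs_cart_prod_iff)
    with H digraph_iso_shared_nbhd_left[OF pg uv w(2)]
    show "digraph_iso (with_proj G\<^sub>1 \<restriction> (nbhd G\<^sub>1 u \<inter> nbhd G\<^sub>1 v)) (with_proj H)"
      by (auto simp: uniform_shared_nbhd_iso_def intro: digraph_iso_trans)
  qed
  show "uniform_shared_nbhd_iso G\<^sub>2 H"
    unfolding uniform_shared_nbhd_iso_def
  proof (intro allI impI)
    fix u v assume uv: "(u, v) \<in> parcs G\<^sub>2"
    then have "((w\<^sub>1, u), (w\<^sub>1, v)) \<in> parcs (G\<^sub>1 \<box> G\<^sub>2)"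
      using w by (simp add: parcs_cart_prod_iff)
    with H digraph_iso_shared_nbhd_right[OF pg uv w(1)]
    show "digraph_iso (with_proj G\<^sub>2 \<restriction> (nbhd G\<^sub>2 u \<inter> nbhd G\<^sub>2 v)) (with_proj H)"
      by (auto simp: uniform_shared_nbhd_iso_def intro: digraph_iso_trans)
  qed
qed

section \<open>Uniqueness of the structure and choice of a witness\<close>

lemma uniform_shared_nbhd_iso_unique:
  assumes "pair_graph G" "parcs G \<noteq> {}"
    and "uniform_shared_nbhd_iso G X" "uniform_shared_nbhd_iso G Y"
  shows "X \<cong>\<^sub>g Y"
proof -
  \<comment> \<open>A single edge decides: its shared neighborhood is isomorphic to both graphs. In
    an edgeless graph both assumptions would be vacuous.\<close>
  obtain u v where uv: "(u, v) \<in> parcs G"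
    using assms(2) by auto
  let ?S = "with_proj G \<restriction> (nbhd G u \<inter> nbhd G v)"
  have "digraph_iso (with_proj X) ?S"
    using assms uv by (intro digraph_iso_induce_swap) (auto simp: uniform_shared_nbhd_iso_def)
  also have "digraph_iso ?S (with_proj Y)"
    using assms uv by (auto simp: uniform_shared_nbhd_iso_def)
  finally show ?thesis
    by (simp add: graph_iso_def)
qed

lemma graph_iso_trans: "X \<cong>\<^sub>g Y \<Longrightarrow> Y \<cong>\<^sub>g Z \<Longrightarrow> X \<cong>\<^sub>g Z"
  by (auto simp: graph_iso_def intro: digraph_iso_trans)

lemma graph_iso_sym: "pair_graph X \<Longrightarrow> X \<cong>\<^sub>g Y \<Longrightarrow> Y \<cong>\<^sub>g X"
  by (simp add: graph_iso_def digraph_iso_swap wf_digraph_with_proj)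

text \<open>\<open>X\<close> may live on any vertex type, while
  \<open>has_uniform_shared_nbhd\<close> wants a witness on the type of \<open>G\<close>; the shared
  neighborhood of one edge is a copy of \<open>X\<close> there.\<close>

lemma has_uniform_shared_nbhdI:
  fixes G :: "'a pair_pre_digraph"
  assumes pg: "pair_graph G" and X: "pair_graph X" "uniform_shared_nbhd_iso G X"
  shows "has_uniform_shared_nbhd G"
proof (cases "parcs G = {}")
  case True
  \<comment> \<open>With no edge to test, any graph serves; the null graph exists on every
    type.\<close>
  have "pair_graph (\<lparr>pverts = {}, parcs = {}\<rparr> :: 'a pair_pre_digraph)"
    by (rule pair_graphI) auto
  with True show ?thesis
    by (auto simp: has_uniform_shared_nbhd_def uniform_shared_nbhd_iso_def)
next
  case False
  then obtain u v where uv: "(u, v) \<in> parcs G"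
    by auto
  define S where "S = nbhd G u \<inter> nbhd G v"
  \<comment> \<open>The induced subgraph rebuilt as a \<open>pair_pre_digraph\<close>, since
    \<open>\<restriction>\<close> yields a general digraph.\<close>
  define H where "H = \<lparr>pverts = S, parcs = parcs G \<inter> S \<times> S\<rparr>"
  have H_eq: "with_proj H = with_proj G \<restriction> S"
    by (auto simp: H_def with_proj_def induce_subgraph_def)
  have "pair_graph H"
    by (rule pair_graphI) (use pg in \<open>auto simp: H_def S_def finite_nbhd pair_graphD(4) intro: pair_graphD(3)\<close>)
  moreover have "X \<cong>\<^sub>g H"
    unfolding graph_iso_def H_eq S_def
    using X(2) uv by (intro digraph_iso_induce_swap[OF pg]) (simp add: uniform_shared_nbhd_iso_def)
  ultimately show ?thesis
    using uniform_shared_nbhd_iso_trans[OF X(2)] by (auto simp: has_uniform_shared_nbhd_def)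
qed

lemma ER_parcs_nonempty:
  assumes "G \<in> ER n d l" "n \<ge> 1" "d > 0"
  shows "parcs G \<noteq> {}"
proof -
  have "pverts G \<noteq> {}"
    using assms by (auto simp: ER_def)
  then obtain u where "card (nbhd G u) = d"
    using assms by (auto simp: ER_def)
  then show ?thesis
    using assms(3) by (auto simp: nbhd_def)
qed

text \<open>Positive degrees guard the necessity: a factor of degree 0 has no edges, so its
  structure graph is arbitrary, while the product still inherits the structure of the other
  factor.\<close>

theorem theorem7:
  fixes G\<^sub>1 :: "'a pair_pre_digraph" and G\<^sub>2 :: "'b pair_pre_digraph"
    and X :: "'c pair_pre_digraph" and Y :: "'d pair_pre_digraph"
    and n\<^sub>1 n\<^sub>2 d\<^sub>1 d\<^sub>2 l :: nat
  assumes "n\<^sub>1 \<ge> 1" and "n\<^sub>2 \<ge> 1"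
    and "pair_graph X" and "pair_graph Y"
    and "G\<^sub>1 \<in> ER n\<^sub>1 d\<^sub>1 l" and "uniform_shared_nbhd_iso G\<^sub>1 X"
    and "G\<^sub>2 \<in> ER n\<^sub>2 d\<^sub>2 l" and "uniform_shared_nbhd_iso G\<^sub>2 Y"
  shows "G\<^sub>1 \<box> G\<^sub>2 \<in> ER (n\<^sub>1 * n\<^sub>2) (d\<^sub>1 + d\<^sub>2) l
    \<and> (0 < d\<^sub>1 \<and> 0 < d\<^sub>2 \<longrightarrow> (has_uniform_shared_nbhd (G\<^sub>1 \<box> G\<^sub>2) \<longleftrightarrow> X \<cong>\<^sub>g Y))
    \<and> (X \<cong>\<^sub>g Y \<longrightarrow> has_uniform_shared_nbhd (G\<^sub>1 \<box> G\<^sub>2)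
         \<and> uniform_shared_nbhd_iso (G\<^sub>1 \<box> G\<^sub>2) X \<and> uniform_shared_nbhd_iso (G\<^sub>1 \<box> G\<^sub>2) Y)"
proof -
  have pg: "pair_graph G\<^sub>1" "pair_graph G\<^sub>2" and ne: "pverts G\<^sub>1 \<noteq> {}" "pverts G\<^sub>2 \<noteq> {}"
    using assms by (auto simp: ER_def)
  have suff: "has_uniform_shared_nbhd (G\<^sub>1 \<box> G\<^sub>2)
      \<and> uniform_shared_nbhd_iso (G\<^sub>1 \<box> G\<^sub>2) X \<and> uniform_shared_nbhd_iso (G\<^sub>1 \<box> G\<^sub>2) Y"
    if XY: "X \<cong>\<^sub>g Y"
  proof -
    \<comment> \<open>Reversing the isomorphism replaces \<open>Y\<close> by \<open>X\<close>, so
      that both factors carry the same structure graph.\<close>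
    have "uniform_shared_nbhd_iso G\<^sub>2 X"
      using assms XY by (blast intro: uniform_shared_nbhd_iso_trans graph_iso_sym)
    then have "uniform_shared_nbhd_iso (G\<^sub>1 \<box> G\<^sub>2) X"
      using assms pg by (intro uniform_shared_nbhd_iso_cart_prod)
    then show ?thesis
      using assms(3) XY pair_graph_cart_prod[OF pg]
      by (blast intro: has_uniform_shared_nbhdI uniform_shared_nbhd_iso_trans)
  qed
  have nec: "X \<cong>\<^sub>g Y" if d: "0 < d\<^sub>1" "0 < d\<^sub>2" and has: "has_uniform_shared_nbhd (G\<^sub>1 \<box> G\<^sub>2)"
  proof -
    obtain H :: "('a \<times> 'b) pair_pre_digraph"
      where H: "uniform_shared_nbhd_iso (G\<^sub>1 \<box> G\<^sub>2) H"
      using has by (auto simp: has_uniform_shared_nbhd_def)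
    \<comment> \<open>The witness \<open>H\<close> of the product is a structure graph for each
      factor, so by uniqueness it links \<open>X\<close> to \<open>Y\<close>; positive degrees
      supply the edges this needs.\<close>
    note H12 = uniform_shared_nbhd_iso_cart_prodD[OF pg ne H]
    have "X \<cong>\<^sub>g H"
      using uniform_shared_nbhd_iso_unique[OF pg(1) ER_parcs_nonempty] assms d H12(1) by blast
    moreover have "H \<cong>\<^sub>g Y"
      using uniform_shared_nbhd_iso_unique[OF pg(2) ER_parcs_nonempty] assms d H12(2) by blast
    ultimately show ?thesis
      by (rule graph_iso_trans)
  qed
  show ?thesis
    using cart_prod_in_ER[OF assms(5,7)] suff nec by blast
qed

end
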